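(* Let $n=2t$ be an even positive integer, let $\xi\in\mathbb{F}_{q^n}\setminus\mathbb{F}_{q^t}$, let $f(z)=\sum_{i=0}^{t-1}A_iz^{q^i}\in\mathcal{L}_{t,q}$ be a scattered polynomial, let $S_{f,\xi}=\{z+\xi f(z)\colon z\in\mathbb{F}_{q^t}\}$ and $U=\mathbb{F}_{q^t}\times S_{f,\xi}$. Then $L_U$ is $\mathrm{P}\Gamma\mathrm{L}(2,q^n)$-equivalent to $L_p$, where, with $\epsilon=\xi^{-1}$, \[p(x)=\mathrm{Tr}_{q^n/q^t}\Big(\frac{A_0+\epsilon^{q^t}}{\epsilon^{q^t}-\epsilon}x+\sum_{i=1}^{t-1}\frac{A_i}{\epsilon^{q^{i+t}}-\epsilon^{q^i}}x^{q^i}\Big)=\mathrm{Tr}_{q^n/q^t}\Big(f\Big(\frac{x}{\epsilon^{q^t}-\epsilon}\Big)\Big)+\mathrm{Tr}_{q^n/q^t}\Big(\frac{\epsilon^{q^t}x}{\epsilon^{q^t}-\epsilon}\Big).\]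
   Context: $\mathcal{L}_{t,q}$ is the set of $q$-polynomials with coefficients in $\mathbb{F}_{q^t}$; $f\in\mathcal{L}_{t,q}$ is scattered if $\dim_{\mathbb{F}_q}\ker(f(x)-mx)\le1$ for every $m\in\mathbb{F}_{q^t}$. $\mathrm{Tr}_{q^n/q^t}(a)=a+a^{q^t}$. For an $\mathbb{F}_q$-subspace $U$ of $\mathbb{F}_{q^n}^2$, $L_U=\{\langle\mathbf u\rangle_{\mathbb{F}_{q^n}}\colon\mathbf u\in U\setminus\{\mathbf0\}\}$, and for a $q$-polynomial $p$ over $\mathbb{F}_{q^n}$, $L_p=\{\langle(x,p(x))\rangle_{\mathbb{F}_{q^n}}\colon x\in\mathbb{F}_{q^n}^*\}$. *)

theory Defs
  imports "HOL-Analysis.Analysis" "HOL-Computational_Algebra.Polynomial"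
begin

definition field_embedding :: "('a::field \<Rightarrow> 'b::field) \<Rightarrow> bool" where
  "field_embedding h \<longleftrightarrow>
     h 1 = 1 \<and> (\<forall>x y. h (x + y) = h x + h y) \<and> (\<forall>x y. h (x * y) = h x * h y)"

definition is_subfield :: "'a::field set \<Rightarrow> bool" where
  "is_subfield K \<longleftrightarrow> 0 \<in> K \<and> 1 \<in> K \<and>
     (\<forall>x\<in>K. \<forall>y\<in>K. x + y \<in> K \<and> x * y \<in> K) \<and> (\<forall>x\<in>K. - x \<in> K \<and> inverse x \<in> K)"

definition q_polynomials :: "nat \<Rightarrow> 'a::field set \<Rightarrow> 'a poly set" where
  "q_polynomials q K =
     {f. \<exists>d a. (\<forall>i\<le>d. a i \<in> K) \<and> f = (\<Sum>i\<le>d. monom (a i) (q ^ i))}"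

text \<open>The ground field of order \<open>q\<close> is the type \<open>'k\<close>, embedded by \<open>\<iota>\<close> into the big
  field; \<open>vector_space.dim\<close> is thus the dimension over the ground field.  A polynomial with
  coefficients in \<open>K\<close> is regarded as a map on \<open>K\<close>, so kernels are taken inside \<open>K\<close>.\<close>

definition scattered_poly :: "('k::field \<Rightarrow> 'a::field) \<Rightarrow> 'a set \<Rightarrow> 'a poly \<Rightarrow> bool" where
  "scattered_poly \<iota> K f \<longleftrightarrow>
     (\<forall>m\<in>K. vector_space.dim (\<lambda>c x. \<iota> c * x) {z \<in> K. poly f z - m * z = 0} \<le> 1)"

text \<open>When \<open>r = q ^ t\<close> and the big field has order \<open>r\<^sup>2\<close>, this is the trace onto the
  subfield of order \<open>r\<close>.  It is polymorphic so that it also applies to polynomials: evaluating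
  \<open>quad_trace r g\<close> at \<open>x\<close> gives the trace of \<open>g(x)\<close>.\<close>

definition quad_trace :: "nat \<Rightarrow> 'a::comm_ring_1 \<Rightarrow> 'a" where
  "quad_trace r a = a + a ^ r"

definition linear_set :: "('a::field ^ 2) set \<Rightarrow> ('a ^ 2) set set" where
  "linear_set U = {vec.span {u} | u. u \<in> U - {0}}"

definition linear_set_poly :: "'a::field poly \<Rightarrow> ('a ^ 2) set set" where
  "linear_set_poly p = {vec.span {vector [x, poly p x]} | x. x \<noteq> 0}"

definition proj_points :: "('a::field ^ 'n) set set" where
  "proj_points = {vec.span {u} | u. u \<noteq> 0}"

definition GammaL :: "('a::field ^ 'n \<Rightarrow> 'a ^ 'n) set" where
  "GammaL = {\<phi>. bij \<phi> \<and> (\<forall>u v. \<phi> (u + v) = \<phi> u + \<phi> v) \<and>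
     (\<exists>\<sigma>. field_embedding \<sigma> \<and> bij \<sigma> \<and> (\<forall>c u. \<phi> (c *s u) = \<sigma> c *s \<phi> u))}"

text \<open>The group of all permutations of the points induced by semilinear bijections, i.e.
  \<open>\<Gamma>L\<close> modulo the scalars.\<close>

definition PGammaL :: "(('a::field ^ 'n) set \<Rightarrow> ('a ^ 'n) set) set" where
  "PGammaL = {restrict (\<lambda>P. \<phi> ` P) proj_points | \<phi>. \<phi> \<in> GammaL}"

definition PGammaL_equivalent :: "('a::field ^ 'n) set set \<Rightarrow> ('a ^ 'n) set set \<Rightarrow> bool" where
  "PGammaL_equivalent L L' \<longleftrightarrow> (\<exists>\<psi>\<in>PGammaL. \<psi> ` L = L')"

end

theory Submission
  imports Defs
begin

text \<open>Put \<open>r = q\<^sup>t\<close> and \<open>\<delta> = \<epsilon>\<^sup>r - \<epsilon>\<close>.  Every \<open>x\<close> in the big field is \<open>u + v\<epsilon>\<close> with unique \<open>u, v \<in> K\<close>,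
  and \<open>v = Tr(-x/\<delta>)\<close>, \<open>u = Tr(\<epsilon>\<^sup>r x/\<delta>)\<close>.  Since \<open>f\<close> is additive and commutes with the Frobenius map
  \<open>x \<mapsto> x\<^sup>r\<close>, it commutes with the trace, so \<open>p(u + v\<epsilon>) = u - f(v)\<close>.  With \<open>u = a + f(v)\<close> the linear map
  \<open>(a, s) \<mapsto> (a + \<epsilon>s, a)\<close> therefore carries the vector \<open>(a, v + \<xi>f(v))\<close> of \<open>U\<close> to
  \<open>(u + v\<epsilon>, p(u + v\<epsilon>))\<close>.\<close>

section \<open>Finite subfields and their power maps\<close>

lemma is_subfield_diff:
  assumes "is_subfield K" "x \<in> K" "y \<in> K"
  shows "x - y \<in> K"
  using assms unfolding is_subfield_def by (metis add_uminus_conv_diff)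

lemma is_subfield_power:
  assumes "is_subfield K" "x \<in> K"
  shows "x ^ k \<in> K"
  using assms by (induction k) (auto simp: is_subfield_def)

lemma is_subfield_sum:
  assumes "is_subfield K" "\<And>i. i \<in> I \<Longrightarrow> g i \<in> K"
  shows "sum g I \<in> K"
  using assms by (induction I rule: infinite_finite_induct) (auto simp: is_subfield_def)

lemma is_subfield_poly:
  assumes "is_subfield K" "\<And>i. coeff f i \<in> K" "x \<in> K"
  shows "poly f x \<in> K"
  unfolding poly_altdef
proof (rule is_subfield_sum[OF assms(1)])
  fix i
  have "coeff f i \<in> K" "x ^ i \<in> K"
    using assms is_subfield_power by auto
  then show "coeff f i * x ^ i \<in> K"
    using assms(1) by (simp add: is_subfield_def)
qed

text \<open>Multiplication by a nonzero \<open>x\<close> permutes the nonzero elements of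
  \<open>K\<close>; comparing their products before and after gives
  \<open>x ^ (card K - 1) = 1\<close>.\<close>

lemma is_subfield_power_card:
  assumes K: "is_subfield K" and fin: "finite K" and x: "x \<in> K"
  shows "x ^ card K = x"
proof (cases "x = 0")
  case True
  have "card K \<noteq> 0"
    using fin x by auto
  then show ?thesis
    using True by simp
next
  case False
  define K' where "K' = K - {0}"
  have "bij_betw ((*) x) K' K'"
  proof (rule bij_betw_byWitness[where f' = "(*) (inverse x)"])
    show "(*) x ` K' \<subseteq> K'" "(*) (inverse x) ` K' \<subseteq> K'"
      using K x False by (auto simp: K'_def is_subfield_def)
  qed (use False in auto)
  then have "(\<Prod>y\<in>K'. x * y) = \<Prod>K'"
    by (rule prod.reindex_bij_betw)
  moreover have "(\<Prod>y\<in>K'. x * y) = x ^ card K' * \<Prod>K'"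
    by (simp add: prod.distrib)
  moreover have "\<Prod>K' \<noteq> 0"
    using fin by (auto simp: K'_def)
  ultimately have "x ^ card K' = 1"
    by simp
  moreover have "card K = Suc (card K')"
    unfolding K'_def using K fin by (intro card.remove) (auto simp: is_subfield_def)
  ultimately show ?thesis
    by simp
qed

text \<open>The polynomial \<open>X ^ card K - X\<close> has at most \<open>card K\<close> roots,
  and \<open>K\<close> already supplies that many. Membership in \<open>K\<close> thereby becomes an
  equation that can be checked by computation.\<close>

lemma mem_is_subfield_iff:
  assumes K: "is_subfield K" and fin: "finite K"
  shows "x \<in> K \<longleftrightarrow> x ^ card K = x"
proof
  assume x: "x ^ card K = x"
  let ?P = "monom 1 (card K) - monom 1 1 :: 'a poly"
  \<comment> \<open>If \<open>card K\<close> were 1, the two monomials of \<open>?P\<close> would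
    cancel.\<close>
  have "card {0, 1 :: 'a} \<le> card K"
    using K fin by (intro card_mono) (auto simp: is_subfield_def)
  then have card: "1 < card K"
    by simp
  then have "coeff ?P (card K) \<noteq> 0"
    by simp
  then have nz: "?P \<noteq> 0"
    by (metis coeff_0)
  have "degree ?P \<le> card K"
    using card by (intro degree_diff_le degree_monom_le[THEN order_trans]) auto
  then have "card {y. poly ?P y = 0} \<le> card K"
    using card_poly_roots_bound[OF nz] by simp
  moreover have "K \<subseteq> {y. poly ?P y = 0}"
    using is_subfield_power_card[OF K fin] by (auto simp: poly_monom)
  ultimately have "K = {y. poly ?P y = 0}"
    using poly_roots_finite[OF nz] by (intro card_seteq) auto
  then show "x \<in> K"
    using x by (auto simp: poly_monom)
qed (rule is_subfield_power_card[OF K fin])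

section \<open>Additivity of the Frobenius map\<close>

lemma finite_field_power_card:
  fixes x :: "'a::{field,finite}"
  shows "x ^ CARD('a) = x"
  by (rule is_subfield_power_card) (auto simp: is_subfield_def)

text \<open>The polynomial \<open>(X + 1)\<^sup>q - X\<^sup>q - 1\<close> has degree below \<open>q\<close> but vanishes on all of a field of
  order \<open>q\<close>.  This gives additivity of \<open>x \<mapsto> x\<^sup>q\<close> without knowing that \<open>q\<close> is a prime power.\<close>

lemma of_nat_card_choose_eq_0:
  assumes "0 < k" "k < CARD('k::{field,finite})"
  shows "of_nat (CARD('k) choose k) = (0::'k)"
proof -
  let ?q = "CARD('k)"
  define P :: "'k poly" where "P = (\<Sum>j = 1..<?q. monom (of_nat (?q choose j)) j)"
  have "poly P x = 0" for x
  proof -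
    have "{..?q} = insert 0 (insert ?q {1..<?q})"
      by auto
    then have "(x + 1) ^ ?q = x ^ ?q + 1 + poly P x"
      by (simp add: binomial_ring P_def poly_sum poly_monom)
    then show ?thesis
      by (simp add: finite_field_power_card)
  qed
  moreover have "degree P < ?q"
    unfolding P_def using assms
    by (intro degree_sum_less) (auto intro: le_less_trans[OF degree_monom_le])
  ultimately have "P = 0"
    by (intro poly_eqI_degree[of UNIV]) auto
  then have "coeff P k = 0"
    by simp
  then show ?thesis
    using assms by (simp add: P_def coeff_sum)
qed

lemma field_embedding_0:
  assumes "field_embedding h"
  shows "h 0 = 0"
  using assms unfolding field_embedding_def by (metis add_cancel_right_right)

lemma field_embedding_of_nat:
  assumes "field_embedding h"
  shows "h (of_nat m) = of_nat m"
  using assms field_embedding_0[OF assms] by (induction m) (auto simp: field_embedding_def)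

text \<open>The inner binomial terms vanish for the exponent \<open>q\<close>, and iterating gives
  \<open>q ^ i\<close>. A commutative ring is allowed so that both the big field and its polynomial
  ring are covered.\<close>

lemma add_power_of_choose_eq_0:
  fixes x y :: "'b::comm_ring_1"
  assumes "0 < q" and "\<And>k. 0 < k \<Longrightarrow> k < q \<Longrightarrow> of_nat (q choose k) = (0::'b)"
  shows "(x + y) ^ (q ^ i) = x ^ (q ^ i) + y ^ (q ^ i)"
proof -
  have q: "(x + y) ^ q = x ^ q + y ^ q" for x y :: 'b
  proof -
    have "{..q} = insert 0 (insert q {1..<q})"
      by auto
    then show ?thesis
      using assms by (simp add: binomial_ring)
  qed
  show ?thesis
  proof (induction i)
    case (Suc i)
    have "(x + y) ^ (q ^ Suc i) = ((x + y) ^ q ^ i) ^ q"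
      by (simp add: mult.commute flip: power_mult)
    also have "\<dots> = (x ^ q ^ i) ^ q + (y ^ q ^ i) ^ q"
      by (simp add: Suc.IH q)
    also have "\<dots> = x ^ q ^ Suc i + y ^ q ^ Suc i"
      by (simp add: mult.commute flip: power_mult)
    finally show ?case .
  qed simp
qed

lemma sum_power_of_add_power:
  fixes g :: "'i \<Rightarrow> 'b::comm_semiring_1"
  assumes "\<And>x y :: 'b. (x + y) ^ Q = x ^ Q + y ^ Q" "0 < Q"
  shows "sum g I ^ Q = (\<Sum>i\<in>I. g i ^ Q)"
  by (induction I rule: infinite_finite_induct) (use assms in \<open>auto simp: zero_power\<close>)

text \<open>The power map is additive and multiplicative and fixes the coefficients, so it passes
  through evaluation.\<close>

lemma poly_power_of_add_power:
  fixes f :: "'b::comm_semiring_1 poly"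
  assumes "\<And>x y :: 'b. (x + y) ^ Q = x ^ Q + y ^ Q" "0 < Q" "\<And>i. coeff f i ^ Q = coeff f i"
  shows "poly f x ^ Q = poly f (x ^ Q)"
  unfolding poly_altdef sum_power_of_add_power[OF assms(1,2)]
  by (simp add: power_mult_distrib assms(3) power_commutes mult.commute flip: power_mult)

lemma coeff_q_polynomials_mem:
  assumes "is_subfield K" "f \<in> q_polynomials q K"
  shows "coeff f i \<in> K"
proof -
  obtain d a where a: "\<And>i. i \<le> d \<Longrightarrow> a i \<in> K" and f: "f = (\<Sum>i\<le>d. monom (a i) (q ^ i))"
    using assms(2) by (auto simp: q_polynomials_def)
  show ?thesis
    unfolding f coeff_sum coeff_monom
    using a assms(1) by (intro is_subfield_sum) (auto simp: is_subfield_def)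
qed

section \<open>Linear sets and projective equivalence\<close>

text \<open>The left side leaves out \<open>x = 0\<close>, the right side the zero vector;
  \<open>poly p 0 = 0\<close> makes these exclusions agree.\<close>

lemma linear_set_poly_eq_linear_set:
  "linear_set_poly p = linear_set {vector [x, poly p x] | x. True}" if "poly p 0 = 0"
proof -
  have "(vector [x, poly p x] :: 'a ^ 2) = 0 \<longleftrightarrow> x = 0" for x
    using that by (auto simp: vec_eq_iff forall_2)
  then show ?thesis
    unfolding linear_set_def linear_set_poly_def by blast
qed

text \<open>A linear bijection is semilinear with the identity as field automorphism; it commutes
  with spans and sends only 0 to 0.\<close>

lemma PGammaL_equivalent_linear_set_image:
  assumes \<phi>: "Vector_Spaces.linear (*s) (*s) \<phi>" and "bij \<phi>"
  shows "PGammaL_equivalent (linear_set U) (linear_set (\<phi> ` U))"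
proof -
  interpret Vector_Spaces.linear "(*s)" "(*s)" \<phi>
    by (rule \<phi>)
  have "\<phi> \<in> GammaL"
    using \<open>bij \<phi>\<close> by (auto simp: GammaL_def add scale field_embedding_def intro!: exI[of _ "\<lambda>x. x"] bij_id[unfolded id_def])
  then have "restrict ((`) \<phi>) proj_points \<in> PGammaL"
    unfolding PGammaL_def by blast
  moreover have "restrict ((`) \<phi>) proj_points ` linear_set U = linear_set (\<phi> ` U)"
  proof -
    have eq: "linear_set V = (\<lambda>u. vec.span {u}) ` (V - {0})" for V :: "('a ^ 2) set"
      by (auto simp: linear_set_def)
    have "restrict ((`) \<phi>) proj_points ` linear_set U = (`) \<phi> ` linear_set U"
      by (rule image_cong) (auto simp: linear_set_def proj_points_def)
    also have "\<dots> = (\<lambda>v. vec.span {v}) ` \<phi> ` (U - {0})"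
      by (simp add: eq image_image flip: span_image)
    also have "\<phi> ` (U - {0}) = \<phi> ` U - {0}"
      using \<open>bij \<phi>\<close> by (simp add: bij_def image_set_diff)
    finally show ?thesis
      by (simp add: eq)
  qed
  ultimately show ?thesis
    unfolding PGammaL_equivalent_def by blast
qed

theorem theorem4p17:
  fixes \<iota> :: "'k::{field,finite} \<Rightarrow> 'a::{field,finite}"
    and q t n :: nat and K S :: "'a set" and U :: "('a ^ 2) set"
    and \<xi> \<epsilon> :: 'a and A :: "nat \<Rightarrow> 'a" and f p :: "'a poly"
  assumes "field_embedding \<iota>"
    and "CARD('k) = q" and "CARD('a) = q ^ n"
    and "n = 2 * t" and "n > 0"
    and "is_subfield K" and "card K = q ^ t"
    and "\<xi> \<notin> K"
    and "f \<in> q_polynomials q K"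
    and "f = (\<Sum>i<t. monom (A i) (q ^ i))"
    and "scattered_poly \<iota> K f"
    and "S = {z + \<xi> * poly f z | z. z \<in> K}"
    and "U = {vector [a, s] | a s. a \<in> K \<and> s \<in> S}"
    and "\<epsilon> = inverse \<xi>"
    and "p = quad_trace (q ^ t)
               (monom ((A 0 + \<epsilon> ^ (q ^ t)) / (\<epsilon> ^ (q ^ t) - \<epsilon>)) 1 +
                (\<Sum>i = 1..<t. monom (A i / (\<epsilon> ^ (q ^ (i + t)) - \<epsilon> ^ (q ^ i))) (q ^ i)))"
  shows "p = quad_trace (q ^ t) (f \<circ>\<^sub>p monom (1 / (\<epsilon> ^ (q ^ t) - \<epsilon>)) 1) +
             quad_trace (q ^ t) (monom (\<epsilon> ^ (q ^ t) / (\<epsilon> ^ (q ^ t) - \<epsilon>)) 1) \<and>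
         PGammaL_equivalent (linear_set U) (linear_set_poly p)"
proof -
  let ?r = "q ^ t"
  define \<delta> where "\<delta> = \<epsilon> ^ ?r - \<epsilon>"
  have K: "is_subfield K" and cardK: "card K = ?r" and "t > 0"
    using assms by auto
  have "q > 0"
    using assms(2) by auto
  have "\<epsilon> \<notin> K"
    using \<open>\<xi> \<notin> K\<close> K unfolding \<open>\<epsilon> = inverse \<xi>\<close> is_subfield_def by (metis inverse_inverse_eq)
  have Kiff: "x \<in> K \<longleftrightarrow> x ^ ?r = x" for x
    using mem_is_subfield_iff[OF K, of x] cardK by simp
  have \<delta>: "\<delta> \<noteq> 0"
    using Kiff[of \<epsilon>] \<open>\<epsilon> \<notin> K\<close> by (auto simp: \<delta>_def)
  have "\<xi> \<noteq> 0"
    using \<open>\<xi> \<notin> K\<close> K by (auto simp: is_subfield_def)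
  then have "\<epsilon> \<noteq> 0" and \<epsilon>\<xi>: "\<epsilon> * \<xi> = 1"
    using assms by auto

  \<comment> \<open>The binomial coefficients vanish in the ground field, and the embedding carries
    this to the big field.\<close>
  have choose: "of_nat (q choose k) = (0::'a)" if "0 < k" "k < q" for k
    using that of_nat_card_choose_eq_0[where 'k = 'k, of k] field_embedding_of_nat[OF assms(1)]
      field_embedding_0[OF assms(1)] assms(2) by metis
  have frob: "(x + y) ^ (q ^ i) = x ^ (q ^ i) + y ^ (q ^ i)" for x y :: 'a and i
    using add_power_of_choose_eq_0 choose \<open>q > 0\<close> by blast
  \<comment> \<open>The trace defining \<open>p\<close> is taken of polynomials, so additivity is
    needed in the polynomial ring as well.\<close>
  have frob_poly: "(x + y) ^ ?r = x ^ ?r + y ^ ?r" for x y :: "'a poly"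
    by (rule add_power_of_choose_eq_0) (use choose \<open>q > 0\<close> in \<open>auto simp: of_nat_poly\<close>)
  have frob_diff: "(x - y) ^ (q ^ i) = x ^ (q ^ i) - y ^ (q ^ i)" for x y :: 'a and i
    using frob[of "x - y" y i] by (simp add: algebra_simps)
  \<comment> \<open>Since \<open>n = 2 * t\<close>, the big field has order
    \<open>?r * ?r\<close>.\<close>
  have frob2: "(x ^ ?r) ^ ?r = x" for x :: 'a
    using finite_field_power_card[of x] assms(3,4) by (simp add: mult_2 power_add flip: power_mult)

  have f_add: "poly f (x + y) = poly f x + poly f y" for x y
    by (simp add: assms(10) poly_sum poly_monom frob algebra_simps sum.distrib)
  have f_0: "poly f 0 = 0"
    using \<open>q > 0\<close> by (simp add: assms(10) poly_sum poly_monom zero_power)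
  have f_minus: "poly f (- x) = - poly f x" for x
    using f_add[of x "- x"] f_0 by (simp add: add_eq_0_iff)
  have f_coeff: "coeff f i \<in> K" for i
    using coeff_q_polynomials_mem[OF K assms(9)] .
  have f_K: "poly f x \<in> K" if "x \<in> K" for x
    using is_subfield_poly[OF K f_coeff that] .
  have f_frob: "poly f x ^ ?r = poly f (x ^ ?r)" for x
    using poly_power_of_add_power[of ?r f x] frob \<open>q > 0\<close> f_coeff Kiff by auto

  have p_eq: "p = quad_trace ?r (f \<circ>\<^sub>p monom (1 / \<delta>) 1) + quad_trace ?r (monom (\<epsilon> ^ ?r / \<delta>) 1)"
  proof -
    have "\<delta> ^ q ^ i = \<epsilon> ^ q ^ (i + t) - \<epsilon> ^ q ^ i" for i
      by (simp add: \<delta>_def frob_diff power_add mult.commute flip: power_mult)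
    moreover have "monom a m \<circ>\<^sub>p monom b 1 = monom (a * b ^ m) m" for a b :: 'a and m
      by (rule poly_eqI) simp
    ultimately have "f \<circ>\<^sub>p monom (1 / \<delta>) 1 =
        (\<Sum>i<t. monom (A i / (\<epsilon> ^ q ^ (i + t) - \<epsilon> ^ q ^ i)) (q ^ i))"
      by (simp add: assms(10) pcompose_sum power_one_over)
    \<comment> \<open>The term for \<open>i = 0\<close> is split off; it merges with
      \<open>\<epsilon> ^ ?r / \<delta>\<close> into the linear coefficient of
      \<open>p\<close>.\<close>
    also have "{..<t} = insert 0 {1..<t}"
      using \<open>t > 0\<close> by auto
    finally have "f \<circ>\<^sub>p monom (1 / \<delta>) 1 + monom (\<epsilon> ^ ?r / \<delta>) 1 =
        monom ((A 0 + \<epsilon> ^ ?r) / \<delta>) 1 +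
        (\<Sum>i = 1..<t. monom (A i / (\<epsilon> ^ q ^ (i + t) - \<epsilon> ^ q ^ i)) (q ^ i))"
      by (simp add: \<delta>_def add_divide_distrib add_monom[symmetric] add_ac)
    moreover have "quad_trace ?r (g + h) = quad_trace ?r g + quad_trace ?r h" for g h :: "'a poly"
      by (simp add: quad_trace_def frob_poly)
    ultimately show ?thesis
      by (metis assms(15) \<delta>_def)
  qed

  \<comment> \<open>The Frobenius map is an involution here and swaps the two terms of
    \<open>\<delta>\<close>. This sign turns the trace of a quotient by \<open>\<delta>\<close> into
    a difference.\<close>
  have "\<delta> ^ ?r = - \<delta>"
    by (simp add: \<delta>_def frob_diff frob2)
  then have tr_div: "quad_trace ?r (y / \<delta>) = (y - y ^ ?r) / \<delta>" for y
    by (simp add: quad_trace_def power_divide diff_divide_distrib)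
  have p_val: "poly p x = poly f ((x - x ^ ?r) / \<delta>) + (\<epsilon> ^ ?r * x - \<epsilon> * x ^ ?r) / \<delta>" for x
  proof -
    have "poly p x = quad_trace ?r (poly f (x / \<delta>)) + quad_trace ?r (\<epsilon> ^ ?r * x / \<delta>)"
      by (simp add: p_eq quad_trace_def poly_pcompose poly_monom poly_power)
    also have "quad_trace ?r (poly f (x / \<delta>)) = poly f (quad_trace ?r (x / \<delta>))"
      by (simp add: quad_trace_def f_frob f_add)
    finally show ?thesis
      by (simp add: tr_div power_mult_distrib frob2)
  qed
  have p_uv: "poly p (u + v * \<epsilon>) = u - poly f v" if "u \<in> K" "v \<in> K" for u v
  proof -
    have pow: "(u + v * \<epsilon>) ^ ?r = u + v * \<epsilon> ^ ?r"
      using that Kiff by (simp add: frob power_mult_distrib)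
    \<comment> \<open>These are the two numerators of \<open>p_val\<close> at
      \<open>u + v * \<epsilon>\<close>.\<close>
    have "u + v * \<epsilon> - (u + v * \<epsilon> ^ ?r) = - v * \<delta>"
      "\<epsilon> ^ ?r * (u + v * \<epsilon>) - \<epsilon> * (u + v * \<epsilon> ^ ?r) = u * \<delta>"
      by (simp_all add: \<delta>_def algebra_simps)
    then show ?thesis
      unfolding p_val pow using \<delta> by (simp add: f_minus)
  qed

  define \<phi> :: "'a ^ 2 \<Rightarrow> 'a ^ 2" where "\<phi> w = vector [w $ 1 + \<epsilon> * w $ 2, w $ 1]" for w
  have "Vector_Spaces.linear (*s) (*s) \<phi>"
    by unfold_locales (auto simp: \<phi>_def vec_eq_iff forall_2 algebra_simps)
  moreover have "bij \<phi>"
  proof (rule o_bij)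
    let ?\<psi> = "\<lambda>w. vector [w $ 2, (w $ 1 - w $ 2) / \<epsilon>] :: 'a ^ 2"
    show "?\<psi> \<circ> \<phi> = id" "\<phi> \<circ> ?\<psi> = id"
      using \<open>\<epsilon> \<noteq> 0\<close> by (auto simp: \<phi>_def fun_eq_iff vec_eq_iff forall_2)
  qed
  moreover have "\<phi> ` U = {vector [x, poly p x] | x. True}"
  proof (intro equalityI subsetI)
    fix w :: "'a ^ 2"
    assume "w \<in> \<phi> ` U"
    then obtain a v where "a \<in> K" "v \<in> K" and w: "w = \<phi> (vector [a, v + \<xi> * poly f v])"
      unfolding assms(12,13) by blast
    define u where "u = a + poly f v"
    have "u \<in> K"
      using K \<open>a \<in> K\<close> f_K[OF \<open>v \<in> K\<close>] by (simp add: u_def is_subfield_def)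
    \<comment> \<open>As \<open>\<epsilon> * \<xi> = 1\<close>, the first coordinate is
      \<open>a + \<epsilon> * v + poly f v\<close>.\<close>
    have "w = vector [u + v * \<epsilon>, a]"
      using \<epsilon>\<xi> by (simp add: w \<phi>_def u_def distrib_left mult.assoc[symmetric] mult.commute add_ac)
    then show "w \<in> {vector [x, poly p x] | x. True}"
      using p_uv[OF \<open>u \<in> K\<close> \<open>v \<in> K\<close>] by (metis (mono_tags, lifting) add_diff_cancel_right' mem_Collect_eq u_def)
  next
    fix w :: "'a ^ 2"
    assume "w \<in> {vector [x, poly p x] | x. True}"
    then obtain x where w: "w = vector [x, poly p x]"
      by blast
    \<comment> \<open>Subtracting \<open>x = u + v * \<epsilon>\<close> from its Frobenius image,
      with \<open>u\<close> and \<open>v\<close> fixed, forces this value of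
      \<open>v\<close>.\<close>
    define v where "v = (x ^ ?r - x) / \<delta>"
    define u where "u = x - v * \<epsilon>"
    have "v \<in> K"
      \<comment> \<open>Numerator and denominator of \<open>v\<close> both change sign under the
        Frobenius map.\<close>
      unfolding Kiff using \<open>\<delta> ^ ?r = - \<delta>\<close> \<delta>
      by (simp add: v_def power_divide frob_diff frob2 field_simps)
    have "v * \<delta> = x ^ ?r - x"
      using \<delta> by (simp add: v_def)
    \<comment> \<open>The equation for \<open>v * \<delta>\<close> rearranges to
      \<open>x ^ ?r - v * \<epsilon> ^ ?r = x - v * \<epsilon>\<close>, so \<open>u\<close> is fixed
      by the Frobenius map.\<close>
    then have "u \<in> K"
      using \<open>v \<in> K\<close> unfolding Kiff
      by (simp add: u_def frob_diff power_mult_distrib \<delta>_def algebra_simps)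
    have "x = u + v * \<epsilon>"
      by (simp add: u_def)
    then have "poly p x = u - poly f v"
      using p_uv[OF \<open>u \<in> K\<close> \<open>v \<in> K\<close>] by simp
    then have "w = \<phi> (vector [u - poly f v, v + \<xi> * poly f v])"
      using \<epsilon>\<xi> \<open>x = u + v * \<epsilon>\<close>
      by (simp add: w \<phi>_def distrib_left mult.assoc[symmetric] mult.commute)
    moreover have "u - poly f v \<in> K"
      using is_subfield_diff[OF K \<open>u \<in> K\<close> f_K[OF \<open>v \<in> K\<close>]] .
    ultimately show "w \<in> \<phi> ` U"
      using \<open>v \<in> K\<close> unfolding assms(12,13) by blast
  qed
  moreover have "poly p 0 = 0"
    using p_val[of 0] \<open>q > 0\<close> by (simp add: f_0 zero_power)
  ultimately have "PGammaL_equivalent (linear_set U) (linear_set_poly p)"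
    using PGammaL_equivalent_linear_set_image[of \<phi> U] linear_set_poly_eq_linear_set[of p] by simp
  then show ?thesis
    using p_eq[unfolded \<delta>_def] by blast
qed

end
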